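(* Let $M,M_1,M_2$ be Orlicz functions satisfying the $\Delta_2$-condition, let $m,n\ge0$ be integers, let $1\le p<\infty$, and let $Z$ be one of $C_\infty^F,O_\infty^F,C_p^F,O_p^F,\ell_p^F$. Then: (i) $Z(M_1,\Delta_m^n)\subseteq Z(M\circ M_1,\Delta_m^n)$; (ii) $Z(M_1,\Delta_m^n)\cap Z(M_2,\Delta_m^n)\subseteq Z(M_1+M_2,\Delta_m^n)$.
   Context: $N=\{1,2,3,\dots\}$. An Orlicz function is a continuous, non-decreasing, convex function $M:[0,\infty)\to[0,\infty)$ with $M(0)=0$, $M(x)>0$ for $x>0$, and $M(x)\to\infty$ as $x\to\infty$. In this paper, $M$ satisfies the $\Delta_2$-condition if there is a constant $K>0$ such that $M(Lx)\le K\,L\,M(x)$ for all $x>0$ and all $L>1$. A fuzzy real number is a map $X:\mathbb R\to[0,1]$. It is convex if $X(t)\ge\min(X(s),X(r))$ whenever $s<t<r$, normal if $X(t_0)=1$ for some $t_0$, and upper semi-continuous if $X^{-1}([0,a+\varepsilon))$ is open for every $\varepsilon>0$ and $a\in[0,1]$. For $0<\alpha\le1$, $X^\alpha=\{t: X(t)\ge\alpha\}$, and $X^0$ is the closure of $\{t:X(t)>0\}$. $R(I)$ denotes the set of upper semi-continuous, normal, convex fuzzy real numbers, with all level sets $X^\alpha$ ($0\le\alpha\le1$) closed bounded intervals. For closed bounded intervals $A=[A^L,A^R]$, $B=[B^L,B^R]$ put $d(A,B)=\max\{|A^L-B^L|,|A^R-B^R|\}$, and for $X,Y\in R(I)$ put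 $\overline d(X,Y)=\sup_{0<\alpha\le1}d(X^\alpha,Y^\alpha)$. For $r\in\mathbb R$, $\overline r\in R(I)$ is defined by $\overline r(t)=1$ if $t=r$ and $0$ otherwise. Subtraction in $R(I)$ is the usual levelwise interval subtraction: if $X^\alpha=[a,b]$ and $Y^\alpha=[c,e]$ then $(X-Y)^\alpha=[a-e,b-c]$. For a sequence $(X_k)_{k\in N}$ in $R(I)$ and $m,n\ge1$: $\Delta_m^0X_k=X_k$ and $\Delta_m^nX_k=\Delta_m^{n-1}X_k-\Delta_m^{n-1}X_{k+m}$; if $m=0$ or $n=0$, $\Delta_m^nX_k=X_k$. For an Orlicz function $G$ the spaces consist of sequences $(X_k)$ in $R(I)$ satisfying, for some $\rho>0$, with $t_k=G\left(\overline d(\Delta_m^nX_k,\overline0)/\rho\right)$: - $C_p^F(G,\Delta_m^n)$: $\sum_{i=1}^\infty\left(\frac1i\sum_{k=1}^i t_k\right)^p<\infty$; - $C_\infty^F(G,\Delta_m^n)$: $\sup_i\frac1i\sum_{k=1}^i t_k<\infty$; - $\ell_p^F(G,\Delta_m^n)$: $\sum_{k=1}^\infty t_k^p<\infty$; - $O_p^F(G,\Delta_m^n)$: $\sum_{i=1}^\infty\frac1i\left(\sum_{k=1}^i t_k\right)^p<\infty$; - $O_\infty^F(G,\Delta_m^n)$: $\sup_i\frac1i\sum_{k=1}^i t_k<\infty$. *)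

theory Defs
  imports "HOL-Analysis.Analysis"
begin

section \<open>Orlicz functions\<close>

text \<open>Functions on the half-line are represented by functions on the reals whose values at
  negative arguments are irrelevant. Values on the half-line are nonnegative by
  monotonicity and \<open>G 0 = 0\<close>.\<close>

definition orlicz :: "(real \<Rightarrow> real) \<Rightarrow> bool" where
  "orlicz G \<longleftrightarrow> continuous_on {0..} G \<and> mono_on {0..} G \<and> convex_on {0..} G \<and>
     G 0 = 0 \<and> (\<forall>x>0. G x > 0) \<and> filterlim G at_top at_top"

definition Delta2 :: "(real \<Rightarrow> real) \<Rightarrow> bool" where
  "Delta2 G \<longleftrightarrow> (\<exists>K>0. \<forall>x>0. \<forall>L>1. G (L * x) \<le> K * L * G x)"

section \<open>Fuzzy real numbers\<close>

definition level :: "(real \<Rightarrow> real) \<Rightarrow> real \<Rightarrow> real set" where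
  "level X \<alpha> = (if \<alpha> = 0 then closure {t. X t > 0} else {t. X t \<ge> \<alpha>})"

definition fuzzy_convex :: "(real \<Rightarrow> real) \<Rightarrow> bool" where
  "fuzzy_convex X \<longleftrightarrow> (\<forall>s t r. s < t \<and> t < r \<longrightarrow> X t \<ge> min (X s) (X r))"

definition fuzzy_normal :: "(real \<Rightarrow> real) \<Rightarrow> bool" where
  "fuzzy_normal X \<longleftrightarrow> (\<exists>t. X t = 1)"

definition fuzzy_usc :: "(real \<Rightarrow> real) \<Rightarrow> bool" where
  "fuzzy_usc X \<longleftrightarrow> (\<forall>\<epsilon>>0. \<forall>a\<in>{0..1}. open (X -` {0..<a + \<epsilon>}))"

definition RI :: "(real \<Rightarrow> real) set" where
  "RI = {X. (\<forall>t. X t \<in> {0..1}) \<and> fuzzy_usc X \<and> fuzzy_normal X \<and> fuzzy_convex X \<and>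
     (\<forall>\<alpha>\<in>{0..1}. \<exists>a b. a \<le> b \<and> level X \<alpha> = {a..b})}"

lemma RI_I:
  assumes r: "\<And>t. 0 \<le> X t" "\<And>t. X t \<le> 1"
    and l: "\<And>\<alpha>. 0 \<le> \<alpha> \<Longrightarrow> \<alpha> \<le> 1 \<Longrightarrow> \<exists>a b. a \<le> b \<and> level X \<alpha> = {a..b}"
  shows "X \<in> RI"
proof -
  have iv: "\<exists>a b. a \<le> b \<and> {t. X t \<ge> \<alpha>} = {a..b}" if "0 < \<alpha>" "\<alpha> \<le> 1" for \<alpha>
    using l[of \<alpha>] that by (simp add: level_def)
  have "open (X -` {0..<c})" if c: "c > 0" for c
  proof (cases "c \<le> 1")
    case True
    then obtain a b where "{t. X t \<ge> c} = {a..b}" using iv[OF c] by blast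
    moreover have "X -` {0..<c} = - {t. X t \<ge> c}" using r by (auto simp: not_le)
    ultimately show ?thesis by (simp add: open_Compl)
  next
    case False
    then have "X t < c" for t using r(2)[of t] by simp
    then have "X -` {0..<c} = UNIV" using r by auto
    then show ?thesis by simp
  qed
  then have usc: "fuzzy_usc X" by (auto simp: fuzzy_usc_def add_nonneg_pos)
  obtain a b where ab: "a \<le> b" "{t. X t \<ge> 1} = {a..b}" using iv[of 1] by auto
  then have "X a = 1" using r(2)[of a] by (auto intro: antisym)
  then have nor: "fuzzy_normal X" by (auto simp: fuzzy_normal_def)
  have "X t \<ge> min (X s) (X q)" if st: "s < t" "t < q" for s t q
  proof (cases "min (X s) (X q) > 0")
    case True
    moreover have "min (X s) (X q) \<le> 1" using r by (simp add: min_le_iff_disj)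
    ultimately obtain a b where ab: "{t. X t \<ge> min (X s) (X q)} = {a..b}"
      using iv by blast
    have "s \<in> {a..b}" "q \<in> {a..b}" unfolding ab[symmetric] by auto
    then have "t \<in> {a..b}" using st by auto
    then show ?thesis unfolding ab[symmetric] by simp
  next
    case False
    then show ?thesis using r(1)[of t] by linarith
  qed
  then have "fuzzy_convex X" unfolding fuzzy_convex_def by blast
  moreover have "\<forall>\<alpha>\<in>{0..1}. \<exists>a b. a \<le> b \<and> level X \<alpha> = {a..b}"
    using l by simp
  moreover have "\<forall>t. X t \<in> {0..1}" using r by simp
  ultimately show ?thesis using usc nor unfolding RI_def by blast
qed

definition crisp :: "real \<Rightarrow> real \<Rightarrow> real" where
  "crisp r = (\<lambda>t. if t = r then 1 else 0)"

lemma crisp_RI: "crisp r \<in> RI"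
proof (rule RI_I)
  fix \<alpha> :: real assume "0 \<le> \<alpha>" "\<alpha> \<le> 1"
  then have "level (crisp r) \<alpha> = {r..r}"
    by (auto simp: level_def crisp_def split: if_splits)
  then show "\<exists>a b. a \<le> b \<and> level (crisp r) \<alpha> = {a..b}" by blast
qed (auto simp: crisp_def)

typedef fuzzy = RI
  morphisms membership Abs_fuzzy
  using crisp_RI by blast

definition fuzzy_of_real :: "real \<Rightarrow> fuzzy" where
  "fuzzy_of_real r = Abs_fuzzy (crisp r)"

definition lev :: "fuzzy \<Rightarrow> real \<Rightarrow> real set" where
  "lev X \<alpha> = level (membership X) \<alpha>"

definition left_end :: "fuzzy \<Rightarrow> real \<Rightarrow> real" where
  "left_end X \<alpha> = Inf (lev X \<alpha>)"

definition right_end :: "fuzzy \<Rightarrow> real \<Rightarrow> real" where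
  "right_end X \<alpha> = Sup (lev X \<alpha>)"

definition fuzzy_dist :: "fuzzy \<Rightarrow> fuzzy \<Rightarrow> real" where
  "fuzzy_dist X Y = (SUP \<alpha>\<in>{0<..1}.
     max \<bar>left_end X \<alpha> - left_end Y \<alpha>\<bar> \<bar>right_end X \<alpha> - right_end Y \<alpha>\<bar>)"

text \<open>Levelwise interval subtraction. The lemmas \<open>ex1_minus\<close> and \<open>lev_minus\<close> below show that
  the definite description is well defined.\<close>

instantiation fuzzy :: minus
begin
definition minus_fuzzy :: "fuzzy \<Rightarrow> fuzzy \<Rightarrow> fuzzy" where
  "X - Y = (THE W. \<forall>\<alpha>\<in>{0..1}.
     lev W \<alpha> = {left_end X \<alpha> - right_end Y \<alpha> .. right_end X \<alpha> - left_end Y \<alpha>})"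
instance ..
end

lemma lev_eq:
  assumes "0 \<le> \<alpha>" "\<alpha> \<le> 1"
  shows "left_end X \<alpha> \<le> right_end X \<alpha>" "lev X \<alpha> = {left_end X \<alpha>..right_end X \<alpha>}"
proof -
  have "\<forall>\<alpha>\<in>{0..1}. \<exists>a b. a \<le> b \<and> level (membership X) \<alpha> = {a..b}"
    using membership[of X] unfolding RI_def by blast
  moreover have "\<alpha> \<in> {0..1}" using assms by simp
  ultimately obtain a b where "a \<le> b" "lev X \<alpha> = {a..b}"
    unfolding lev_def by blast
  then show "left_end X \<alpha> \<le> right_end X \<alpha>" "lev X \<alpha> = {left_end X \<alpha>..right_end X \<alpha>}"
    by (simp_all add: left_end_def right_end_def)
qed

lemma membership_range: "0 \<le> membership X t" "membership X t \<le> 1"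
  using membership[of X] by (auto simp: RI_def)

lemma lev_pos: "0 < \<alpha> \<Longrightarrow> lev X \<alpha> = {t. membership X t \<ge> \<alpha>}"
  by (simp add: lev_def level_def)

lemma lev_antimono:
  assumes "0 \<le> \<alpha>" "\<alpha> \<le> \<beta>"
  shows "lev X \<beta> \<subseteq> lev X \<alpha>"
  using assms closure_subset[of "{t. membership X t > 0}"]
  by (cases "\<alpha> = 0") (auto simp: lev_def level_def)

lemma ends_mono:
  assumes "0 \<le> \<alpha>" "\<alpha> \<le> \<beta>" "\<beta> \<le> 1"
  shows "left_end X \<alpha> \<le> left_end X \<beta>" "right_end X \<beta> \<le> right_end X \<alpha>"
  using lev_antimono[OF assms(1,2), of X] lev_eq[of \<alpha> X] lev_eq[of \<beta> X] assms by auto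

lemma fuzzy_eqI:
  assumes "\<And>\<alpha>. 0 < \<alpha> \<Longrightarrow> \<alpha> \<le> 1 \<Longrightarrow> lev X \<alpha> = lev Y \<alpha>"
  shows "X = Y"
proof -
  have le: "membership A t \<le> membership B t"
    if "\<And>\<alpha>. 0 < \<alpha> \<Longrightarrow> \<alpha> \<le> 1 \<Longrightarrow> lev A \<alpha> = lev B \<alpha>" for A B t
  proof (cases "membership A t > 0")
    case True
    then show ?thesis using that[of "membership A t"] membership_range[of A t]
      by (auto simp: lev_pos)
  next
    case False
    then show ?thesis using membership_range[of B t] by linarith
  qed
  have "membership X = membership Y"
    using le[of X Y] le[of Y X] assms by (metis antisym ext)
  then show ?thesis by (simp add: membership_inject)
qed

lemma ends_left_cont:
  assumes "0 < \<alpha>" "\<alpha> \<le> 1" "e > 0"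
  shows "\<exists>\<beta>. 0 < \<beta> \<and> \<beta> < \<alpha> \<and> right_end X \<beta> < right_end X \<alpha> + e"
    "\<exists>\<beta>. 0 < \<beta> \<and> \<beta> < \<alpha> \<and> left_end X \<beta> > left_end X \<alpha> - e"
proof -
  have key: "membership X t \<ge> \<alpha>" if "\<And>\<beta>. 0 < \<beta> \<Longrightarrow> \<beta> < \<alpha> \<Longrightarrow> t \<in> lev X \<beta>" for t
  proof (rule ccontr)
    assume "\<not> membership X t \<ge> \<alpha>"
    then have "membership X t < \<alpha>" by simp
    then obtain \<beta> where "membership X t < \<beta>" "\<beta> < \<alpha>" using dense by blast
    then show False using that[of \<beta>] membership_range(1)[of X t] by (auto simp: lev_pos)
  qed
  show "\<exists>\<beta>. 0 < \<beta> \<and> \<beta> < \<alpha> \<and> right_end X \<beta> < right_end X \<alpha> + e"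
  proof (rule ccontr)
    assume *: "\<not> ?thesis"
    have "right_end X \<alpha> + e \<in> lev X \<beta>" if b: "0 < \<beta>" "\<beta> < \<alpha>" for \<beta>
    proof -
      have "right_end X \<beta> \<ge> right_end X \<alpha> + e" using * b by (meson not_less)
      then show ?thesis
        using b assms lev_eq[of \<beta> X] lev_eq(1)[of \<alpha> X] ends_mono[of \<beta> \<alpha> X] by simp
    qed
    then have "right_end X \<alpha> + e \<in> lev X \<alpha>" using key assms by (auto simp: lev_pos)
    then show False using lev_eq[of \<alpha> X] assms by auto
  qed
  show "\<exists>\<beta>. 0 < \<beta> \<and> \<beta> < \<alpha> \<and> left_end X \<beta> > left_end X \<alpha> - e"
  proof (rule ccontr)
    assume *: "\<not> ?thesis"
    have "left_end X \<alpha> - e \<in> lev X \<beta>" if b: "0 < \<beta>" "\<beta> < \<alpha>" for \<beta>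
    proof -
      have "left_end X \<beta> \<le> left_end X \<alpha> - e" using * b by (meson not_less)
      then show ?thesis
        using b assms lev_eq[of \<beta> X] lev_eq(1)[of \<alpha> X] ends_mono[of \<beta> \<alpha> X] by simp
    qed
    then have "left_end X \<alpha> - e \<in> lev X \<alpha>" using key assms by (auto simp: lev_pos)
    then show False using lev_eq[of \<alpha> X] assms by auto
  qed
qed

lemma ends_at_0:
  assumes "e > 0"
  shows "\<exists>\<beta>. 0 < \<beta> \<and> \<beta> \<le> 1 \<and> right_end X \<beta> > right_end X 0 - e"
    "\<exists>\<beta>. 0 < \<beta> \<and> \<beta> \<le> 1 \<and> left_end X \<beta> < left_end X 0 + e"
proof -
  have key: "\<exists>\<beta> t. 0 < \<beta> \<and> \<beta> \<le> 1 \<and> t \<in> lev X \<beta> \<and> dist t x < e" if "x \<in> lev X 0" for x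
  proof -
    have "x \<in> closure {t. membership X t > 0}" using that by (simp add: lev_def level_def)
    then obtain t where t: "membership X t > 0" "dist t x < e"
      using assms unfolding closure_approachable by blast
    then show ?thesis using membership_range[of X t]
      by (intro exI[of _ "membership X t"] exI[of _ t]) (auto simp: lev_pos)
  qed
  have "right_end X 0 \<in> lev X 0" "left_end X 0 \<in> lev X 0" using lev_eq[of 0 X] by auto
  from key[OF this(1)] key[OF this(2)]
  obtain \<beta> t \<gamma> u where b: "0 < \<beta>" "\<beta> \<le> 1" "t \<in> lev X \<beta>" "dist t (right_end X 0) < e"
    and g: "0 < \<gamma>" "\<gamma> \<le> 1" "u \<in> lev X \<gamma>" "dist u (left_end X 0) < e" by blast
  show "\<exists>\<beta>. 0 < \<beta> \<and> \<beta> \<le> 1 \<and> right_end X \<beta> > right_end X 0 - e"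
    using b lev_eq[of \<beta> X] by (intro exI[of _ \<beta>]) (auto simp: dist_real_def)
  show "\<exists>\<beta>. 0 < \<beta> \<and> \<beta> \<le> 1 \<and> left_end X \<beta> < left_end X 0 + e"
    using g lev_eq[of \<gamma> X] by (intro exI[of _ \<gamma>]) (auto simp: dist_real_def)
qed

lemma ex1_minus:
  "\<exists>!W. \<forall>\<alpha>\<in>{0..1}. lev W \<alpha> =
     {left_end X \<alpha> - right_end Y \<alpha> .. right_end X \<alpha> - left_end Y \<alpha>}"
proof -
  define l u where "l \<alpha> = left_end X \<alpha> - right_end Y \<alpha>"
    and "u \<alpha> = right_end X \<alpha> - left_end Y \<alpha>" for \<alpha>
  define A where "A t = insert 0 {\<alpha>. 0 < \<alpha> \<and> \<alpha> \<le> 1 \<and> l \<alpha> \<le> t \<and> t \<le> u \<alpha>}" for t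
  define W where "W t = Sup (A t)" for t
  have lu: "l \<alpha> \<le> u \<alpha>" if "0 \<le> \<alpha>" "\<alpha> \<le> 1" for \<alpha>
    using lev_eq(1)[OF that, of X] lev_eq(1)[OF that, of Y] by (simp add: l_def u_def)
  have mono: "l \<alpha> \<le> l \<beta>" "u \<beta> \<le> u \<alpha>" if "0 \<le> \<alpha>" "\<alpha> \<le> \<beta>" "\<beta> \<le> 1" for \<alpha> \<beta>
    using ends_mono[OF that, of X] ends_mono[OF that, of Y] by (simp_all add: l_def u_def)
  have bdd: "bdd_above (A t)" for t unfolding A_def by (auto intro!: bdd_aboveI[of _ 1])
  have W0: "0 \<le> W t" for t unfolding W_def by (rule cSup_upper[OF _ bdd]) (simp add: A_def)
  have W1: "W t \<le> 1" for t unfolding W_def by (rule cSup_least) (auto simp: A_def)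
  have pos: "{t. W t \<ge> \<alpha>} = {l \<alpha>..u \<alpha>}" if a: "0 < \<alpha>" "\<alpha> \<le> 1" for \<alpha>
  proof (rule set_eqI, rule iffI)
    fix t assume "t \<in> {l \<alpha>..u \<alpha>}"
    then have "\<alpha> \<in> A t" using a by (simp add: A_def)
    then show "t \<in> {t. W t \<ge> \<alpha>}" unfolding W_def using cSup_upper[OF _ bdd] by simp
  next
    fix t assume "t \<in> {t. W t \<ge> \<alpha>}"
    then have W: "W t \<ge> \<alpha>" by simp
    have in_b: "l \<beta> \<le> t \<and> t \<le> u \<beta>" if b: "0 < \<beta>" "\<beta> < \<alpha>" for \<beta>
    proof -
      have "\<beta> < Sup (A t)" using W b by (simp add: W_def)
      then obtain \<gamma> where "\<gamma> \<in> A t" "\<beta> < \<gamma>" by (subst (asm) less_cSup_iff) (auto simp: bdd A_def)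
      then show ?thesis using b mono[of \<beta> \<gamma>] unfolding A_def by auto
    qed
    have "t \<le> u \<alpha> + e" if e: "e > 0" for e
    proof -
      obtain \<beta> where b: "0 < \<beta>" "\<beta> < \<alpha>" "right_end X \<beta> < right_end X \<alpha> + e/2"
        using ends_left_cont(1)[of \<alpha> "e/2" X] a e by auto
      obtain \<gamma> where g: "0 < \<gamma>" "\<gamma> < \<alpha>" "left_end Y \<gamma> > left_end Y \<alpha> - e/2"
        using ends_left_cont(2)[of \<alpha> "e/2" Y] a e by auto
      have "t \<le> u (max \<beta> \<gamma>)" using in_b[of "max \<beta> \<gamma>"] b g by auto
      moreover have "right_end X (max \<beta> \<gamma>) \<le> right_end X \<beta>" "left_end Y \<gamma> \<le> left_end Y (max \<beta> \<gamma>)"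
        using ends_mono[of \<beta> "max \<beta> \<gamma>" X] ends_mono[of \<gamma> "max \<beta> \<gamma>" Y] b g a by auto
      ultimately show ?thesis using b g unfolding u_def by linarith
    qed
    then have 1: "t \<le> u \<alpha>" by (rule field_le_epsilon)
    have "l \<alpha> \<le> t + e" if e: "e > 0" for e
    proof -
      obtain \<beta> where b: "0 < \<beta>" "\<beta> < \<alpha>" "right_end Y \<beta> < right_end Y \<alpha> + e/2"
        using ends_left_cont(1)[of \<alpha> "e/2" Y] a e by auto
      obtain \<gamma> where g: "0 < \<gamma>" "\<gamma> < \<alpha>" "left_end X \<gamma> > left_end X \<alpha> - e/2"
        using ends_left_cont(2)[of \<alpha> "e/2" X] a e by auto
      have "l (max \<beta> \<gamma>) \<le> t" using in_b[of "max \<beta> \<gamma>"] b g by auto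
      moreover have "right_end Y (max \<beta> \<gamma>) \<le> right_end Y \<beta>" "left_end X \<gamma> \<le> left_end X (max \<beta> \<gamma>)"
        using ends_mono[of \<beta> "max \<beta> \<gamma>" Y] ends_mono[of \<gamma> "max \<beta> \<gamma>" X] b g a by auto
      ultimately show ?thesis using b g unfolding l_def by linarith
    qed
    then have "l \<alpha> \<le> t" by (rule field_le_epsilon)
    with 1 show "t \<in> {l \<alpha>..u \<alpha>}" by simp
  qed
  define S where "S = {t. W t > 0}"
  have S: "t \<in> S \<longleftrightarrow> (\<exists>\<alpha>. 0 < \<alpha> \<and> \<alpha> \<le> 1 \<and> t \<in> {l \<alpha>..u \<alpha>})" for t
  proof
    assume "t \<in> S"
    then have "W t > 0" by (simp add: S_def)
    then show "\<exists>\<alpha>. 0 < \<alpha> \<and> \<alpha> \<le> 1 \<and> t \<in> {l \<alpha>..u \<alpha>}"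
      using pos[of "W t"] W1[of t] by (intro exI[of _ "W t"]) auto
  next
    assume "\<exists>\<alpha>. 0 < \<alpha> \<and> \<alpha> \<le> 1 \<and> t \<in> {l \<alpha>..u \<alpha>}"
    then obtain \<alpha> where a: "0 < \<alpha>" "\<alpha> \<le> 1" "t \<in> {l \<alpha>..u \<alpha>}" by blast
    then have "W t \<ge> \<alpha>" using pos[OF a(1,2)] by blast
    then show "t \<in> S" using a(1) by (simp add: S_def)
  qed
  have zero: "closure S = {l 0..u 0}"
  proof
    show "closure S \<subseteq> {l 0..u 0}"
    proof (rule closure_minimal)
      show "S \<subseteq> {l 0..u 0}"
      proof
        fix t assume "t \<in> S"
        then obtain \<alpha> where "0 < \<alpha>" "\<alpha> \<le> 1" "t \<in> {l \<alpha>..u \<alpha>}" using S by blast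
        then show "t \<in> {l 0..u 0}" using mono[of 0 \<alpha>] by auto
      qed
    qed simp
    have "is_interval S"
      unfolding is_interval_1
    proof (intro ballI allI impI)
      fix s q t assume sq: "s \<in> S" "q \<in> S" and t: "s \<le> t \<and> t \<le> q"
      obtain \<alpha> \<beta> where a: "0 < \<alpha>" "\<alpha> \<le> 1" "s \<in> {l \<alpha>..u \<alpha>}" and b: "0 < \<beta>" "\<beta> \<le> 1" "q \<in> {l \<beta>..u \<beta>}"
        using sq S by blast
      have "l (min \<alpha> \<beta>) \<le> s" "q \<le> u (min \<alpha> \<beta>)"
        using mono[of "min \<alpha> \<beta>" \<alpha>] mono[of "min \<alpha> \<beta>" \<beta>] a b by auto
      then show "t \<in> S" using a b t unfolding S by (intro exI[of _ "min \<alpha> \<beta>"]) auto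
    qed
    then have "convex (closure S)" by (simp add: is_interval_convex_1 convex_closure)
    then have int: "is_interval (closure S)" by (simp add: is_interval_convex_1)
    have "u 0 \<in> closure S" unfolding closure_approachable
    proof (intro allI impI)
      fix e :: real assume e: "e > 0"
      obtain \<beta> where b: "0 < \<beta>" "\<beta> \<le> 1" "right_end X \<beta> > right_end X 0 - e/2"
        using ends_at_0(1)[of "e/2" X] e by auto
      obtain \<gamma> where g: "0 < \<gamma>" "\<gamma> \<le> 1" "left_end Y \<gamma> < left_end Y 0 + e/2"
        using ends_at_0(2)[of "e/2" Y] e by auto
      let ?m = "min \<beta> \<gamma>"
      have "right_end X \<beta> \<le> right_end X ?m" "left_end Y ?m \<le> left_end Y \<gamma>"
        using ends_mono[of ?m \<beta> X] ends_mono[of ?m \<gamma> Y] b g by auto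
      moreover have "u ?m \<le> u 0" using mono[of 0 ?m] b g by auto
      ultimately have "dist (u ?m) (u 0) < e" using b g unfolding u_def dist_real_def by linarith
      moreover have "u ?m \<in> S" using b g lu[of ?m] unfolding S by (intro exI[of _ ?m]) auto
      ultimately show "\<exists>y\<in>S. dist y (u 0) < e" by blast
    qed
    moreover have "l 0 \<in> closure S" unfolding closure_approachable
    proof (intro allI impI)
      fix e :: real assume e: "e > 0"
      obtain \<beta> where b: "0 < \<beta>" "\<beta> \<le> 1" "right_end Y \<beta> > right_end Y 0 - e/2"
        using ends_at_0(1)[of "e/2" Y] e by auto
      obtain \<gamma> where g: "0 < \<gamma>" "\<gamma> \<le> 1" "left_end X \<gamma> < left_end X 0 + e/2"
        using ends_at_0(2)[of "e/2" X] e by auto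
      let ?m = "min \<beta> \<gamma>"
      have "right_end Y \<beta> \<le> right_end Y ?m" "left_end X ?m \<le> left_end X \<gamma>"
        using ends_mono[of ?m \<beta> Y] ends_mono[of ?m \<gamma> X] b g by auto
      moreover have "l 0 \<le> l ?m" using mono[of 0 ?m] b g by auto
      ultimately have "dist (l ?m) (l 0) < e" using b g unfolding l_def dist_real_def by linarith
      moreover have "l ?m \<in> S" using b g lu[of ?m] unfolding S by (intro exI[of _ ?m]) auto
      ultimately show "\<exists>y\<in>S. dist y (l 0) < e" by blast
    qed
    ultimately show "{l 0..u 0} \<subseteq> closure S"
      using int unfolding is_interval_1 by (meson atLeastAtMost_iff subsetI)
  qed
  have lev: "level W \<alpha> = {l \<alpha>..u \<alpha>}" if "0 \<le> \<alpha>" "\<alpha> \<le> 1" for \<alpha>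
    using pos[of \<alpha>] zero that by (auto simp: level_def S_def)
  then have "W \<in> RI" by (intro RI_I W0 W1) (use lu in blast)
  then have "\<forall>\<alpha>\<in>{0..1}. lev (Abs_fuzzy W) \<alpha> = {l \<alpha>..u \<alpha>}"
    using lev by (simp add: lev_def Abs_fuzzy_inverse)
  moreover have "V = V'" if "\<forall>\<alpha>\<in>{0..1}. lev V \<alpha> = {l \<alpha>..u \<alpha>}"
    "\<forall>\<alpha>\<in>{0..1}. lev V' \<alpha> = {l \<alpha>..u \<alpha>}" for V V'
    using that by (intro fuzzy_eqI) simp
  ultimately have "\<exists>!W. \<forall>\<alpha>\<in>{0..1}. lev W \<alpha> = {l \<alpha>..u \<alpha>}" by blast
  then show ?thesis by (simp add: l_def u_def)
qed

lemma lev_minus: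
  assumes "0 \<le> \<alpha>" "\<alpha> \<le> 1"
  shows "lev (X - Y) \<alpha> = {left_end X \<alpha> - right_end Y \<alpha> .. right_end X \<alpha> - left_end Y \<alpha>}"
  using theI'[OF ex1_minus[of X Y]] assms unfolding minus_fuzzy_def by simp

section \<open>Generalized differences and the sequence spaces\<close>

text \<open>A sequence indexed by \<open>1, 2, \<dots>\<close> is a function on the naturals whose value at \<open>0\<close> is
  never used.\<close>

fun fdiff :: "nat \<Rightarrow> nat \<Rightarrow> (nat \<Rightarrow> fuzzy) \<Rightarrow> nat \<Rightarrow> fuzzy" where
  "fdiff m 0 X k = X k"
| "fdiff m (Suc n) X k = (if m = 0 then X k else fdiff m n X k - fdiff m n X (k + m))"

definition modular ::
    "(real \<Rightarrow> real) \<Rightarrow> nat \<Rightarrow> nat \<Rightarrow> real \<Rightarrow> (nat \<Rightarrow> fuzzy) \<Rightarrow> nat \<Rightarrow> real" where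
  "modular G m n \<rho> X k = G (fuzzy_dist (fdiff m n X k) (fuzzy_of_real 0) / \<rho>)"

type_synonym seq_space = "(real \<Rightarrow> real) \<Rightarrow> nat \<Rightarrow> nat \<Rightarrow> (nat \<Rightarrow> fuzzy) set"

text \<open>The terms of all series below are nonnegative when \<open>G\<close> is an Orlicz function, so
  \<open>summable_on\<close> expresses finiteness of the sum.\<close>

definition C_p :: "real \<Rightarrow> seq_space" where
  "C_p p G m n = {X. \<exists>\<rho>>0.
     (\<lambda>i. ((1 / real i) * (\<Sum>k=1..i. modular G m n \<rho> X k)) powr p) summable_on {1..}}"

definition C_inf :: seq_space where
  "C_inf G m n = {X. \<exists>\<rho>>0.
     bdd_above ((\<lambda>i. (1 / real i) * (\<Sum>k=1..i. modular G m n \<rho> X k)) ` {1..})}"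

definition l_p :: "real \<Rightarrow> seq_space" where
  "l_p p G m n = {X. \<exists>\<rho>>0. (\<lambda>k. modular G m n \<rho> X k powr p) summable_on {1..}}"

definition O_p :: "real \<Rightarrow> seq_space" where
  "O_p p G m n = {X. \<exists>\<rho>>0.
     (\<lambda>i. (1 / real i) * (\<Sum>k=1..i. modular G m n \<rho> X k) powr p) summable_on {1..}}"

text \<open>In the source this space has the same definition as \<open>C_inf\<close>.\<close>

definition O_inf :: seq_space where
  "O_inf G m n = {X. \<exists>\<rho>>0.
     bdd_above ((\<lambda>i. (1 / real i) * (\<Sum>k=1..i. modular G m n \<rho> X k)) ` {1..})}"

end

theory Submission
  imports Defs
begin

text \<open>An Orlicz function with the \<open>\<Delta>\<^sub>2\<close>-condition of the paper grows at most linearly: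
  \<open>M x \<le> C * x\<close>, by convexity on \<open>[0,1]\<close> and by \<open>\<Delta>\<^sub>2\<close> at \<open>1\<close> beyond. Each of the five spaces
  asks that a nonnegative sequence of modulars lie in a set closed under sums and under
  domination up to a constant. For (i) the modular of \<open>M \<circ> M\<^sub>1\<close> is dominated by \<open>C\<close> times that
  of \<open>M\<^sub>1\<close> with the same \<open>\<rho>\<close>; for (ii) one takes the larger of the two \<open>\<rho>\<close>.\<close>

lemma Delta2_linear_bound:
  assumes M: "orlicz M" and D: "Delta2 M"
  obtains C where "C > 0" "\<And>x. x \<ge> 0 \<Longrightarrow> M x \<le> C * x"
proof -
  obtain K where K: "K > 0" "\<And>x L. x > 0 \<Longrightarrow> L > 1 \<Longrightarrow> M (L * x) \<le> K * L * M x"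
    using D unfolding Delta2_def by blast
  have M1: "M 1 > 0" and M0: "M 0 = 0" and conv: "convex_on {0..} M"
    using M by (auto simp: orlicz_def)
  \<comment> \<open>In the constant, the 1 serves \<open>x \<le> 1\<close>, where \<open>M\<close>
    lies below its chord from 0 to 1; the \<open>K\<close> serves \<open>x > 1\<close>, where the
    condition is applied at the point 1 with factor \<open>x\<close>.\<close>
  have "M x \<le> max 1 K * M 1 * x" if x: "x \<ge> 0" for x
  proof (cases "x \<le> 1")
    case True
    have "M x \<le> x * M 1"
      using convex_onD[OF conv, of x 0 1] x True M0 by simp
    also have "\<dots> \<le> x * (max 1 K * M 1)"
      using x M1 by (intro mult_left_mono) auto
    finally show ?thesis by (simp add: ac_simps)
  next
    case False
    then have "M x \<le> K * (x * M 1)" using K(2)[of 1 x] by simp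
    also have "\<dots> \<le> max 1 K * (x * M 1)"
      using x M1 by (intro mult_right_mono) auto
    finally show ?thesis by (simp add: ac_simps)
  qed
  moreover have "max 1 K * M 1 > 0" using M1 by simp
  ultimately show thesis using that by blast
qed

lemma orlicz_mono: "orlicz G \<Longrightarrow> 0 \<le> x \<Longrightarrow> x \<le> y \<Longrightarrow> G x \<le> G y"
  by (auto simp: orlicz_def mono_on_def)

lemma orlicz_nonneg: "orlicz G \<Longrightarrow> 0 \<le> x \<Longrightarrow> 0 \<le> G x"
  using orlicz_mono[of G 0 x] by (simp add: orlicz_def)

text \<open>A real supremum can be bounded below by one of its terms only once the family is known
  to be bounded above. Level sets shrink as \<alpha> grows, so the endpoints at 0 bound all others;
  the term at \<alpha> = 1 then does it.\<close>

lemma fuzzy_dist_nonneg: "0 \<le> fuzzy_dist X Y"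
proof -
  let ?f = "\<lambda>\<alpha>. max \<bar>left_end X \<alpha> - left_end Y \<alpha>\<bar> \<bar>right_end X \<alpha> - right_end Y \<alpha>\<bar>"
  let ?b = "\<lambda>Z. \<bar>left_end Z 0\<bar> + \<bar>right_end Z 0\<bar>"
  have ends: "\<bar>left_end Z \<alpha>\<bar> \<le> ?b Z" "\<bar>right_end Z \<alpha>\<bar> \<le> ?b Z"
    if "\<alpha> \<in> {0<..1}" for Z \<alpha>
    using ends_mono[of 0 \<alpha> Z] lev_eq(1)[of \<alpha> Z] that by auto
  have "?f \<alpha> \<le> ?b X + ?b Y" if "\<alpha> \<in> {0<..1}" for \<alpha>
  proof (rule max.boundedI)
    show "\<bar>left_end X \<alpha> - left_end Y \<alpha>\<bar> \<le> ?b X + ?b Y"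
      by (rule order_trans[OF abs_triangle_ineq4 add_mono[OF ends(1)[OF that] ends(1)[OF that]]])
    show "\<bar>right_end X \<alpha> - right_end Y \<alpha>\<bar> \<le> ?b X + ?b Y"
      by (rule order_trans[OF abs_triangle_ineq4 add_mono[OF ends(2)[OF that] ends(2)[OF that]]])
  qed
  then have "bdd_above (?f ` {0<..1})" by (rule bdd_above.I2)
  then have "?f 1 \<le> fuzzy_dist X Y"
    unfolding fuzzy_dist_def by (rule cSUP_upper[rotated]) simp
  moreover have "0 \<le> ?f 1" by (simp add: le_max_iff_disj)
  ultimately show ?thesis by (rule order_trans[rotated])
qed

lemma modular_nonneg: "orlicz G \<Longrightarrow> \<rho> > 0 \<Longrightarrow> 0 \<le> modular G m n \<rho> X k"
  by (simp add: modular_def orlicz_nonneg fuzzy_dist_nonneg)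

text \<open>Membership in two spaces comes with two unrelated scales; this permits passing to a
  common larger one.\<close>

lemma modular_antimono:
  assumes "orlicz G" "\<rho> > 0" "\<rho> \<le> \<sigma>"
  shows "modular G m n \<sigma> X k \<le> modular G m n \<rho> X k"
  unfolding modular_def
proof (rule orlicz_mono[OF assms(1)])
  let ?d = "fuzzy_dist (fdiff m n X k) (fuzzy_of_real 0)"
  show "0 \<le> ?d / \<sigma>" "?d / \<sigma> \<le> ?d / \<rho>"
    using assms(2,3) by (auto simp: fuzzy_dist_nonneg intro: divide_left_mono)
qed

text \<open>Closure under sums and under domination in one condition; \<open>s = t\<close> gives
  plain domination. No sign is required of \<open>C\<close>, which is why
  \<open>\<bar>C\<bar>\<close> appears in the estimates below.\<close>

definition solid_additive :: "((nat \<Rightarrow> real) \<Rightarrow> bool) \<Rightarrow> bool" where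
  "solid_additive P \<longleftrightarrow> (\<forall>C s t u.
     (\<forall>k. 0 \<le> s k \<and> 0 \<le> t k \<and> 0 \<le> u k \<and> u k \<le> C * (s k + t k)) \<longrightarrow> P s \<longrightarrow> P t \<longrightarrow> P u)"

lemma solid_additiveI:
  assumes "\<And>C s t u. \<lbrakk>\<And>k. 0 \<le> s k; \<And>k. 0 \<le> t k; \<And>k. 0 \<le> u k;
    \<And>k. u k \<le> C * (s k + t k); P s; P t\<rbrakk> \<Longrightarrow> P u"
  shows "solid_additive P"
  unfolding solid_additive_def
proof (intro allI impI)
  fix C s t u
  assume "\<forall>k. 0 \<le> s k \<and> 0 \<le> t k \<and> 0 \<le> u k \<and> u k \<le> C * (s k + t k)" "P s" "P t"
  then show "P u" using assms[of s t u C] by simp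
qed

lemma solid_additiveD:
  assumes "solid_additive P" "\<And>k. 0 \<le> s k" "\<And>k. 0 \<le> t k" "\<And>k. 0 \<le> u k"
    "\<And>k. u k \<le> C * (s k + t k)" "P s" "P t"
  shows "P u"
proof -
  have "\<forall>k. 0 \<le> s k \<and> 0 \<le> t k \<and> 0 \<le> u k \<and> u k \<le> C * (s k + t k)"
    using assms(2-5) by simp
  then show ?thesis
    by (rule assms(1)[unfolded solid_additive_def, THEN spec, THEN spec, THEN spec, THEN spec,
          THEN mp, THEN mp, THEN mp, OF _ assms(6,7)])
qed

text \<open>Bounding \<open>a + b\<close> by twice the maximum suffices, since the power of the
  maximum is one of the two summands on the right. No convexity of the power is used.\<close>

lemma powr_sum_bound:
  fixes a b c C p :: real
  assumes "0 \<le> a" "0 \<le> b" "0 \<le> c" "c \<le> C * (a + b)" "0 \<le> p"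
  shows "c powr p \<le> (2 * \<bar>C\<bar>) powr p * (a powr p + b powr p)"
proof -
  have "C * (a + b) \<le> \<bar>C\<bar> * (2 * max a b)"
    using assms by (intro mult_mono) auto
  then have "c \<le> (2 * \<bar>C\<bar>) * max a b" using assms(4) by simp
  then have "c powr p \<le> ((2 * \<bar>C\<bar>) * max a b) powr p"
    using assms by (intro powr_mono2) auto
  also have "\<dots> = (2 * \<bar>C\<bar>) powr p * max a b powr p"
    using assms by (simp add: powr_mult)
  also have "\<dots> \<le> (2 * \<bar>C\<bar>) powr p * (a powr p + b powr p)"
    by (intro mult_left_mono) (auto simp: max_def)
  finally show ?thesis .
qed

text \<open>The weight lets one lemma cover all three series: weight 1 for \<open>C_p\<close> and
  \<open>l_p\<close>, weight \<open>1 / real i\<close> for \<open>O_p\<close>.\<close>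

lemma solid_additive_weighted_powr:
  assumes w: "\<And>i. 0 \<le> w i" and p: "0 \<le> p"
  shows "solid_additive (\<lambda>v. (\<lambda>i. w i * v i powr p) summable_on A)"
proof (rule solid_additiveI)
  fix C s t u
  assume nn: "\<And>k. 0 \<le> s k" "\<And>k. 0 \<le> t k" "\<And>k. 0 \<le> u k"
    and le: "\<And>k. u k \<le> C * (s k + t k)"
    and "(\<lambda>i. w i * s i powr p) summable_on A" "(\<lambda>i. w i * t i powr p) summable_on A"
  then have "(\<lambda>i. (2 * \<bar>C\<bar>) powr p * (w i * s i powr p + w i * t i powr p)) summable_on A"
    by (intro summable_on_cmult_right summable_on_add)
  then show "(\<lambda>i. w i * u i powr p) summable_on A"
  proof (rule summable_on_comparison_test)
    fix i
    have "w i * u i powr p \<le> w i * ((2 * \<bar>C\<bar>) powr p * (s i powr p + t i powr p))"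
      by (intro mult_left_mono powr_sum_bound nn le p w)
    then show "w i * u i powr p
        \<le> (2 * \<bar>C\<bar>) powr p * (w i * s i powr p + w i * t i powr p)"
      by (simp add: algebra_simps)
  qed (simp add: w)
qed

lemma solid_additive_bdd_above: "solid_additive (\<lambda>v. bdd_above (v ` A))"
proof (rule solid_additiveI)
  fix C s t u
  assume nn: "\<And>k. 0 \<le> s k" "\<And>k. 0 \<le> t k" "\<And>k. 0 \<le> (u k :: real)"
    and le: "\<And>k. u k \<le> C * (s k + t k)"
    and bs: "bdd_above (s ` A)" and bt: "bdd_above (t ` A)"
  obtain S where "\<And>k. k \<in> A \<Longrightarrow> s k \<le> S" using bs by (auto simp: bdd_above_def)
  moreover obtain T where "\<And>k. k \<in> A \<Longrightarrow> t k \<le> T" using bt by (auto simp: bdd_above_def)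
  ultimately have "C * (s k + t k) \<le> \<bar>C\<bar> * (S + T)" if "k \<in> A" for k
    using that nn by (intro mult_mono add_mono) auto
  then have "u k \<le> \<bar>C\<bar> * (S + T)" if "k \<in> A" for k
    using le[of k] that by fastforce
  then show "bdd_above (u ` A)" by (rule bdd_above.I2)
qed

text \<open>Scaled partial sums form a linear map with nonnegative coefficients, so nonnegativity
  and the domination pass through it with the same \<open>C\<close>.\<close>

lemma solid_additive_scaled_partial_sums:
  assumes P: "solid_additive P" and c: "\<And>i. 0 \<le> c i"
  shows "solid_additive (\<lambda>v. P (\<lambda>i. c i * (\<Sum>k=1..i. v k)))"
proof (rule solid_additiveI)
  fix C s t u
  assume nn: "\<And>k. 0 \<le> s k" "\<And>k. 0 \<le> t k" "\<And>k. 0 \<le> u k"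
    and le: "\<And>k. u k \<le> C * (s k + t k)"
    and Pst: "P (\<lambda>i. c i * (\<Sum>k=1..i. s k))" "P (\<lambda>i. c i * (\<Sum>k=1..i. t k))"
  have "c i * (\<Sum>k=1..i. u k) \<le> C * (c i * (\<Sum>k=1..i. s k) + c i * (\<Sum>k=1..i. t k))" for i
  proof -
    have "c i * (\<Sum>k=1..i. u k) \<le> c i * (\<Sum>k=1..i. C * (s k + t k))"
      by (intro mult_left_mono sum_mono le c)
    also have "\<dots> = C * (c i * (\<Sum>k=1..i. s k) + c i * (\<Sum>k=1..i. t k))"
      by (simp add: sum.distrib algebra_simps flip: sum_distrib_left)
    finally show ?thesis .
  qed
  then show "P (\<lambda>i. c i * (\<Sum>k=1..i. u k))"
    by (intro solid_additiveD[OF P _ _ _ _ Pst] mult_nonneg_nonneg sum_nonneg nn c)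
qed

text \<open>The point is that \<open>P\<close> is chosen before \<open>G\<close>, \<open>m\<close>
  and \<open>n\<close>: a single \<open>P\<close> then describes the spaces of all the Orlicz
  functions being compared.\<close>

lemma seq_space_cases:
  assumes "Z \<in> {C_inf, O_inf, C_p p, O_p p, l_p p}" "1 \<le> p"
  obtains P where "solid_additive P"
    "\<And>G m n. Z G m n = {X. \<exists>\<rho>>0. P (modular G m n \<rho> X)}"
proof -
  have wp: "solid_additive (\<lambda>v. (\<lambda>i. w i * v i powr p) summable_on {1..})"
    if "\<And>i. 0 \<le> w i" for w
    using that assms(2) by (intro solid_additive_weighted_powr) auto
  have mean: "solid_additive (\<lambda>v. P (\<lambda>i. (1 / real i) * (\<Sum>k=1..i. v k)))"
    if "solid_additive P" for P
    using that by (rule solid_additive_scaled_partial_sums) simp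
  consider "Z = C_inf \<or> Z = O_inf" | "Z = C_p p" | "Z = O_p p" | "Z = l_p p"
    using assms(1) by blast
  then show thesis
  proof cases
    case 1
    then show thesis
      using that[OF mean[OF solid_additive_bdd_above[of "{1..}"]]]
      by (auto simp: C_inf_def O_inf_def)
  next
    case 2
    then show thesis
      using that[OF mean[OF wp[of "\<lambda>_. 1"]]] by (simp add: C_p_def)
  next
    case 3
    \<comment> \<open>Here \<open>1 / real i\<close> stands outside the power, so it is the weight
      of the series, and the partial sums carry the factor 1 instead of forming means.\<close>
    have "solid_additive (\<lambda>v. (\<lambda>i. (1 / real i) * (\<Sum>k=1..i. v k) powr p) summable_on {1..})"
      using solid_additive_scaled_partial_sums[OF wp[of "\<lambda>i. 1 / real i"], of "\<lambda>_. 1"] by simp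
    from that[OF this] 3 show thesis by (simp add: O_p_def)
  next
    case 4
    then show thesis using that[OF wp[of "\<lambda>_. 1"]] by (simp add: l_p_def)
  qed
qed

theorem theorem3p7:
  fixes M M\<^sub>1 M\<^sub>2 :: "real \<Rightarrow> real" and m n :: nat and p :: real and Z :: seq_space
  assumes "orlicz M" "Delta2 M"
    and "orlicz M\<^sub>1" "Delta2 M\<^sub>1"
    and "orlicz M\<^sub>2" "Delta2 M\<^sub>2"
    and "1 \<le> p"
    and "Z \<in> {C_inf, O_inf, C_p p, O_p p, l_p p}"
  shows "Z M\<^sub>1 m n \<subseteq> Z (M \<circ> M\<^sub>1) m n \<and>
    Z M\<^sub>1 m n \<inter> Z M\<^sub>2 m n \<subseteq> Z (\<lambda>x. M\<^sub>1 x + M\<^sub>2 x) m n"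
proof -
  obtain P where P: "solid_additive P"
    and Z: "\<And>G m n. Z G m n = {X. \<exists>\<rho>>0. P (modular G m n \<rho> X)}"
    using seq_space_cases[OF assms(8,7)] by blast
  obtain C where C: "C > 0" "\<And>x. x \<ge> 0 \<Longrightarrow> M x \<le> C * x"
    using Delta2_linear_bound[OF assms(1,2)] by blast
  have "P (modular (M \<circ> M\<^sub>1) m n \<rho> X)" if \<rho>: "\<rho> > 0" and PX: "P (modular M\<^sub>1 m n \<rho> X)" for \<rho> X
  proof (rule solid_additiveD[OF P _ _ _ _ PX PX])
    fix k
    have nn: "0 \<le> modular M\<^sub>1 m n \<rho> X k" using modular_nonneg[OF assms(3) \<rho>] .
    have eq: "modular (M \<circ> M\<^sub>1) m n \<rho> X k = M (modular M\<^sub>1 m n \<rho> X k)"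
      by (simp add: modular_def)
    show "0 \<le> modular (M \<circ> M\<^sub>1) m n \<rho> X k"
      unfolding eq using orlicz_nonneg[OF assms(1) nn] .
    \<comment> \<open>Both dominating sequences are the modular of \<open>M\<^sub>1\<close>, hence
      the half.\<close>
    show "modular (M \<circ> M\<^sub>1) m n \<rho> X k \<le> C / 2 * (modular M\<^sub>1 m n \<rho> X k + modular M\<^sub>1 m n \<rho> X k)"
      unfolding eq using C(2)[OF nn] by simp
  qed (rule modular_nonneg[OF assms(3) \<rho>])+
  moreover have "P (modular (\<lambda>x. M\<^sub>1 x + M\<^sub>2 x) m n (max \<rho> \<sigma>) X)"
    if pos: "\<rho> > 0" "\<sigma> > 0" and PX: "P (modular M\<^sub>1 m n \<rho> X)" "P (modular M\<^sub>2 m n \<sigma> X)" for \<rho> \<sigma> X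
  proof (rule solid_additiveD[OF P _ _ _ _ PX])
    fix k
    have eq: "modular (\<lambda>x. M\<^sub>1 x + M\<^sub>2 x) m n (max \<rho> \<sigma>) X k =
        modular M\<^sub>1 m n (max \<rho> \<sigma>) X k + modular M\<^sub>2 m n (max \<rho> \<sigma>) X k"
      by (simp add: modular_def)
    show "0 \<le> modular (\<lambda>x. M\<^sub>1 x + M\<^sub>2 x) m n (max \<rho> \<sigma>) X k"
      unfolding eq using pos assms(3,5) by (intro add_nonneg_nonneg modular_nonneg) auto
    show "modular (\<lambda>x. M\<^sub>1 x + M\<^sub>2 x) m n (max \<rho> \<sigma>) X k \<le>
        1 * (modular M\<^sub>1 m n \<rho> X k + modular M\<^sub>2 m n \<sigma> X k)"
      unfolding eq mult_1 using pos assms(3,5) by (intro add_mono modular_antimono) auto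
  qed (use pos assms(3,5) in \<open>simp_all add: modular_nonneg\<close>)
  \<comment> \<open>The rule given to \<open>blast\<close> supplies positivity of the new scale
    \<open>max \<rho> \<sigma>\<close>.\<close>
  ultimately show ?thesis
    unfolding Z by (blast intro: less_le_trans[OF _ max.cobounded1])
qed

end
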